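(* If $T\ge0$ is an unbiased shift such that $\mathbb{P}_0\{B_T=0\}=1$ and $\mathbb{P}_0\{T>0\}>0$, then $$\mathbb{E}_0T=\infty.$$
   Context: Let $\Omega$ be the set of continuous functions $\omega:\mathbb{R}\to\mathbb{R}$ with the Kolmogorov product $\sigma$-algebra, let $B=(B_t)_{t\in\mathbb{R}}$ be the identity (coordinate process) on $\Omega$, and let $\mathbb{P}_0$ be the law of a two-sided standard Brownian motion with $B_0=0$, with expectation $\mathbb{E}_0$. A random time is a measurable function $T$ of $B$ with values in $\mathbb{R}$ (not assumed to be a stopping time). $T$ is an unbiased shift if, under $\mathbb{P}_0$, $(B_{T+t}-B_T)_{t\in\mathbb{R}}$ is a two-sided standard Brownian motion independent of $B_T$. *)

theory Defs
  imports "HOL-Probability.Probability"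
begin

definition path_space :: "(real \<Rightarrow> real) measure" where
  "path_space = restrict_space (PiM UNIV (\<lambda>_. borel)) {\<omega>. continuous_on UNIV \<omega>}"

text \<open>
  Two-sided Brownian motion is described by its increments over the whole real line; since
  the time grids may contain \<open>0\<close>, this amounts to \<open>X t\<close> and \<open>X (- t)\<close>, \<open>t \<ge> 0\<close>, being two
  independent one-sided standard Brownian motions. The second parameter of
  \<^const>\<open>normal_density\<close> is the standard deviation.
\<close>

definition two_sided_BM :: "'a measure \<Rightarrow> (real \<Rightarrow> 'a \<Rightarrow> real) \<Rightarrow> bool" where
  "two_sided_BM M X \<longleftrightarrow>
     prob_space M \<and>
     (\<forall>t. X t \<in> borel_measurable M) \<and>
     (\<forall>\<omega>\<in>space M. continuous_on UNIV (\<lambda>t. X t \<omega>)) \<and>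
     (AE \<omega> in M. X 0 \<omega> = 0) \<and>
     (\<forall>s t. s < t \<longrightarrow>
        distributed M lborel (\<lambda>\<omega>. X t \<omega> - X s \<omega>) (normal_density 0 (sqrt (t - s)))) \<and>
     (\<forall>(n::nat) (t::nat \<Rightarrow> real). (\<forall>i<n. t i < t (Suc i)) \<longrightarrow>
        prob_space.indep_vars M (\<lambda>_. borel)
          (\<lambda>i \<omega>. X (t (Suc i)) \<omega> - X (t i) \<omega>) {..<n})"

text \<open>
  The law of two-sided standard Brownian motion started at \<open>0\<close>: the measure on path space
  under which the coordinate process is such a Brownian motion.
\<close>

definition BM_law :: "(real \<Rightarrow> real) measure \<Rightarrow> bool" where
  "BM_law P \<longleftrightarrow> sets P = sets path_space \<and> two_sided_BM P (\<lambda>t \<omega>. \<omega> t)"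

definition random_time :: "((real \<Rightarrow> real) \<Rightarrow> real) \<Rightarrow> bool" where
  "random_time T \<longleftrightarrow> T \<in> borel_measurable path_space"

definition shifted_path :: "((real \<Rightarrow> real) \<Rightarrow> real) \<Rightarrow> (real \<Rightarrow> real) \<Rightarrow> real \<Rightarrow> real" where
  "shifted_path T \<omega> = (\<lambda>t. \<omega> (T \<omega> + t) - \<omega> (T \<omega>))"

text \<open>
  Independence of the shifted path and \<open>B\<^sub>T\<close> is independence of the sigma-algebras they
  generate; \<open>indep_var\<close> is not applicable because the two random elements have different types.
\<close>

definition unbiased_shift ::
    "(real \<Rightarrow> real) measure \<Rightarrow> ((real \<Rightarrow> real) \<Rightarrow> real) \<Rightarrow> bool" where
  "unbiased_shift P T \<longleftrightarrow>
     random_time T \<and>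
     two_sided_BM P (\<lambda>t \<omega>. shifted_path T \<omega> t) \<and>
     prob_space.indep_set P
       (sets (vimage_algebra (space P) (shifted_path T) path_space))
       (sets (vimage_algebra (space P) (\<lambda>\<omega>. \<omega> (T \<omega>)) borel))"

end

theory Submission imports Defs begin

text \<open>
  The law of two-sided Brownian motion is determined by its increments, so the map
  \<open>\<theta> \<omega> = shifted_path T \<omega>\<close> preserves \<open>P\<close>. Fix a positive integrable function \<open>f \<le> 1\<close> (here the
  standard normal density) and put \<open>g = \<integral>\<^sub>0\<^sup>T f(B\<^sub>s) ds\<close>. With the iterates
  \<open>T\<^sub>n = T + T \<circ> \<theta> + \<dots> + T \<circ> \<theta>\<^bsup>n-1\<^esup>\<close>, the condition \<open>B\<^sub>T = 0\<close> gives
  \<open>n E g = E \<integral>\<^sub>0\<^bsup>T\<^sub>n\<^esup> f(B\<^sub>s) ds \<le> E \<integral>\<^sub>0\<^bsup>K n\<^esup> f(B\<^sub>s) ds + E (T\<^sub>n - K n)\<^sup>+\<close>.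
  The first term is \<open>o(n)\<close> since \<open>E f(B\<^sub>s) \<le> s\<^bsup>-1/2\<^esup>\<close>, the second is at most \<open>n E (T - K)\<^sup>+\<close> by
  subadditivity of the positive part. If \<open>E T < \<infinity>\<close>, letting \<open>n\<close> and then \<open>K\<close> tend to infinity yields
  \<open>E g = 0\<close>, and \<open>f > 0\<close> forces \<open>T = 0\<close> almost surely.
\<close>

section \<open>Uniqueness of the law of two-sided Brownian motion\<close>

lemma two_sided_BM_prob_space: "two_sided_BM M X \<Longrightarrow> prob_space M"
  by (simp add: two_sided_BM_def)

lemma two_sided_BM_measurable: "two_sided_BM M X \<Longrightarrow> X t \<in> borel_measurable M"
  by (simp add: two_sided_BM_def)

text \<open>Independence and the Gaussian marginals fix the joint law of the increments as a product
  that no longer mentions \<open>M\<close> or \<open>X\<close>. The product criterion for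
  independence is applied to a nonempty index set, whence \<open>n > 0\<close>.\<close>

lemma two_sided_BM_distr_increments:
  assumes "two_sided_BM M X" and "\<And>i. i < n \<Longrightarrow> t i < t (Suc i)" and "n > 0"
  shows "distr M (PiM {..<n} (\<lambda>_. borel)) (\<lambda>\<omega>. \<lambda>i\<in>{..<n}. X (t (Suc i)) \<omega> - X (t i) \<omega>) =
    PiM {..<n} (\<lambda>i. density lborel (normal_density 0 (sqrt (t (Suc i) - t i))))"
proof -
  interpret prob_space M using assms(1) by (rule two_sided_BM_prob_space)
  note [measurable] = two_sided_BM_measurable[OF assms(1)]
  have indep: "indep_vars (\<lambda>_. borel) (\<lambda>i \<omega>. X (t (Suc i)) \<omega> - X (t i) \<omega>) {..<n}"
    using assms by (simp add: two_sided_BM_def)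
  have "distr M (PiM {..<n} (\<lambda>_. borel)) (\<lambda>\<omega>. \<lambda>i\<in>{..<n}. X (t (Suc i)) \<omega> - X (t i) \<omega>) =
      PiM {..<n} (\<lambda>i. distr M borel (\<lambda>\<omega>. X (t (Suc i)) \<omega> - X (t i) \<omega>))"
    using indep \<open>n > 0\<close> by (subst indep_vars_iff_distr_eq_PiM[symmetric]) auto
  also have "\<dots> = PiM {..<n} (\<lambda>i. density lborel (normal_density 0 (sqrt (t (Suc i) - t i))))"
  proof (rule PiM_cong)
    fix i assume "i \<in> {..<n}"
    then have "distributed M lborel (\<lambda>\<omega>. X (t (Suc i)) \<omega> - X (t i) \<omega>)
        (normal_density 0 (sqrt (t (Suc i) - t i)))"
      using assms by (simp add: two_sided_BM_def)
    moreover have "distr M borel (\<lambda>\<omega>. X (t (Suc i)) \<omega> - X (t i) \<omega>) =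
        distr M lborel (\<lambda>\<omega>. X (t (Suc i)) \<omega> - X (t i) \<omega>)"
      by (rule distr_cong) auto
    ultimately show "distr M borel (\<lambda>\<omega>. X (t (Suc i)) \<omega> - X (t i) \<omega>) =
        density lborel (normal_density 0 (sqrt (t (Suc i) - t i)))"
      by (simp add: distributed_distr_eq_density)
  qed simp
  finally show ?thesis .
qed

text \<open>The grid \<open>t\<close> passes through 0 and all times in \<open>J\<close>, and
  \<open>index\<close> locates them on it. Since \<open>X 0\<close> vanishes almost surely,
  \<open>X j\<close> is a difference of two partial sums of increments, both counted from the left
  end of the grid. The right-hand side depends on the grid alone, so it is common to all Brownian
  motions.\<close>

lemma two_sided_BM_emeasure_cylinder:
  fixes t :: "nat \<Rightarrow> real" and index :: "real \<Rightarrow> nat"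
  assumes BM: "two_sided_BM M X" and t: "\<And>i. i < n \<Longrightarrow> t i < t (Suc i)" and "n > 0"
    and J: "finite J" "\<And>j. j \<in> insert 0 J \<Longrightarrow> index j \<le> n" "\<And>j. j \<in> insert 0 J \<Longrightarrow> t (index j) = j"
    and A: "\<And>j. j \<in> J \<Longrightarrow> A j \<in> sets borel"
  shows "emeasure M {\<omega> \<in> space M. \<forall>j\<in>J. X j \<omega> \<in> A j} =
    emeasure (PiM {..<n} (\<lambda>i. density lborel (normal_density 0 (sqrt (t (Suc i) - t i)))))
      {d \<in> space (PiM {..<n} (\<lambda>_. borel)). \<forall>j\<in>J. (\<Sum>i<index j. d i) - (\<Sum>i<index 0. d i) \<in> A j}"
    (is "_ = emeasure _ ?S")
proof -
  note [measurable] = two_sided_BM_measurable[OF BM] A J(1)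
  have [measurable]: "(\<lambda>d. \<Sum>i<index j. d i :: real) \<in> borel_measurable (PiM {..<n} (\<lambda>_. borel))"
    if "j \<in> insert 0 J" for j
    using J(2)[OF that]
    by (intro borel_measurable_sum measurable_component_singleton) auto
  have S[measurable]: "?S \<in> sets (PiM {..<n} (\<lambda>_. borel))"
    by (rule sets.sets_Collect_finite_All) (use J(1) in \<open>auto intro!: measurable_sets_Collect\<close>)
  let ?D = "\<lambda>\<omega>. \<lambda>i\<in>{..<n}. X (t (Suc i)) \<omega> - X (t i) \<omega>"
  have D[measurable]: "?D \<in> measurable M (PiM {..<n} (\<lambda>_. borel))"
    by measurable
  have tele: "(\<Sum>i<index j. ?D \<omega> i) = X j \<omega> - X (t 0) \<omega>" if "j \<in> insert 0 J" for j \<omega>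
  proof -
    have "(\<Sum>i<index j. ?D \<omega> i) = (\<Sum>i<index j. X (t (Suc i)) \<omega> - X (t i) \<omega>)"
      using J(2)[OF that] by (intro sum.cong) auto
    also have "\<dots> = X (t (index j)) \<omega> - X (t 0) \<omega>"
      by (rule sum_lessThan_telescope)
    finally show ?thesis using J(3)[OF that] by simp
  qed
  have X0: "AE \<omega> in M. X 0 \<omega> = 0"
    using BM by (simp add: two_sided_BM_def)
  have "emeasure M {\<omega> \<in> space M. \<forall>j\<in>J. X j \<omega> \<in> A j} = emeasure M (?D -` ?S \<inter> space M)"
  \<comment> \<open>The two events may differ where \<open>X 0\<close> is nonzero, which is a null
    set.\<close>
  proof (rule emeasure_eq_AE)
    show "AE \<omega> in M. (\<omega> \<in> {\<omega> \<in> space M. \<forall>j\<in>J. X j \<omega> \<in> A j}) = (\<omega> \<in> ?D -` ?S \<inter> space M)"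
      using X0
    proof eventually_elim
      case (elim \<omega>)
      have "(\<Sum>i<index j. ?D \<omega> i) - (\<Sum>i<index 0. ?D \<omega> i) = X j \<omega>" if "j \<in> J" for j
        using that elim by (subst (1 2) tele) auto
      moreover have "?D \<omega> \<in> space (PiM {..<n} (\<lambda>_. borel))"
        by (simp add: space_PiM)
      ultimately show ?case by (auto simp del: restrict_apply)
    qed
    show "{\<omega> \<in> space M. \<forall>j\<in>J. X j \<omega> \<in> A j} \<in> sets M"
      by (rule sets.sets_Collect_finite_All) (use J(1) in \<open>auto intro!: measurable_sets_Collect\<close>)
  qed measurable
  also have "\<dots> = emeasure (distr M (PiM {..<n} (\<lambda>_. borel)) ?D) ?S"
    by (simp add: emeasure_distr)
  also have "distr M (PiM {..<n} (\<lambda>_. borel)) ?D =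
      PiM {..<n} (\<lambda>i. density lborel (normal_density 0 (sqrt (t (Suc i) - t i))))"
    by (rule two_sided_BM_distr_increments) (use BM t \<open>n > 0\<close> in auto)
  finally show ?thesis .
qed

lemma two_sided_BM_finite_dimensional_unique:
  fixes A :: "real \<Rightarrow> real set"
  assumes X: "two_sided_BM M X" and Y: "two_sided_BM N Y" and J: "finite J"
    and A: "\<And>j. j \<in> J \<Longrightarrow> A j \<in> sets borel"
  shows "emeasure M {\<omega> \<in> space M. \<forall>j\<in>J. X j \<omega> \<in> A j} =
    emeasure N {\<omega> \<in> space N. \<forall>j\<in>J. Y j \<omega> \<in> A j}"
proof -
  \<comment> \<open>The time 0 is the reference point from which \<open>X j\<close> is recovered;
    adding 1 guarantees two grid points, hence at least one increment.\<close>
  define ts where "ts = sorted_list_of_set (insert 0 (insert 1 J))"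
  have set_ts: "set ts = insert 0 (insert 1 J)" and sorted: "sorted_wrt (<) ts"
    using J unfolding ts_def by (simp_all only: set_sorted_list_of_set finite_insert strict_sorted_list_of_set)
  have "card (set ts) \<ge> card {0, 1 :: real}"
    unfolding set_ts using J by (intro card_mono) auto
  then have len: "length ts \<ge> 2"
    using card_length[of ts] by simp
  define n where "n = length ts - 1"
  have n: "n > 0" using len by (simp add: n_def)
  have t: "ts ! i < ts ! Suc i" if "i < n" for i
    using that sorted by (intro sorted_wrt_nth_less[of "(<)"]) (auto simp: n_def)
  have "\<forall>j\<in>insert 0 J. \<exists>i\<le>n. ts ! i = j"
  proof
    fix j assume "j \<in> insert 0 J"
    then have "j \<in> set ts" using set_ts by auto
    then obtain i where "i < length ts" "ts ! i = j" by (auto simp: in_set_conv_nth)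
    then show "\<exists>i\<le>n. ts ! i = j" by (intro exI[of _ i]) (auto simp: n_def)
  qed
  then obtain index where index: "\<And>j. j \<in> insert 0 J \<Longrightarrow> index j \<le> n"
      "\<And>j. j \<in> insert 0 J \<Longrightarrow> ts ! index j = j"
    by metis
  show ?thesis
    using two_sided_BM_emeasure_cylinder[where t="(!) ts", OF X t n J index A]
      two_sided_BM_emeasure_cylinder[where t="(!) ts", OF Y t n J index A]
    by simp
qed

lemma space_path_space: "space path_space = {\<omega>. continuous_on UNIV \<omega>}"
  by (auto simp: path_space_def space_restrict_space space_PiM)

lemma measurable_path_space_component: "(\<lambda>\<omega>. \<omega> t) \<in> borel_measurable path_space"
  unfolding path_space_def by (rule measurable_restrict_space1) simp

lemma measurable_path_spaceI:
  assumes "\<And>t. (\<lambda>x. F x t) \<in> borel_measurable M"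
    and "\<And>x. x \<in> space M \<Longrightarrow> continuous_on UNIV (F x)"
  shows "F \<in> measurable M path_space"
  unfolding path_space_def
  by (rule measurable_restrict_space2) (use assms in \<open>auto intro!: measurable_PiM_single'\<close>)

lemma two_sided_BM_measurable_path:
  assumes "two_sided_BM M X"
  shows "(\<lambda>\<omega> t. X t \<omega>) \<in> measurable M path_space"
  using assms by (intro measurable_path_spaceI) (auto simp: two_sided_BM_def)

text \<open>The finite-dimensional laws agree, and cylinder sets are an intersection-stable
  generator of the product sigma-algebra. The laws are therefore compared on the full product first
  and then carried over to its trace on the continuous functions.\<close>

lemma two_sided_BM_distr:
  assumes BM: "two_sided_BM M X" and P: "BM_law P"
  shows "distr M path_space (\<lambda>\<omega> t. X t \<omega>) = P"
proof -
  let ?Pi = "PiM UNIV (\<lambda>_::real. borel :: real measure)"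
  have sets_P: "sets P = sets path_space" and P': "two_sided_BM P (\<lambda>t \<omega>. \<omega> t)"
    using P by (auto simp: BM_law_def)
  have space_P: "space P = space path_space" by (rule sets_eq_imp_space_eq[OF sets_P])
  note X = two_sided_BM_measurable_path[OF BM]
  interpret M: prob_space M using BM by (rule two_sided_BM_prob_space)
  have id: "(\<lambda>\<omega>. \<omega>) \<in> measurable path_space ?Pi"
    unfolding path_space_def by (rule measurable_restrict_space1) simp
  have idP: "(\<lambda>\<omega>. \<omega>) \<in> measurable P ?Pi"
    using id sets_P by (simp cong: measurable_cong_sets)
  have XPi: "(\<lambda>\<omega> t. X t \<omega>) \<in> measurable M ?Pi"
    using measurable_compose[OF X id] .
  have eq: "distr M ?Pi (\<lambda>\<omega> t. X t \<omega>) = distr P ?Pi (\<lambda>\<omega>. \<omega>)"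
  proof (rule measure_eqI_PiM_infinite)
    show "finite_measure (distr M ?Pi (\<lambda>\<omega> t. X t \<omega>))"
      using M.prob_space_distr[OF XPi] by (simp add: prob_space.finite_measure)
    fix A :: "real \<Rightarrow> real set" and J :: "real set"
    assume J: "finite J" and A: "\<And>i. i \<in> J \<Longrightarrow> A i \<in> sets borel"
    let ?E = "prod_emb UNIV (\<lambda>_::real. borel :: real measure) J (Pi\<^sub>E J A)"
    have E: "?E \<in> sets ?Pi" using J A by (intro sets_PiM_I) auto
    have E_iff: "f \<in> ?E \<longleftrightarrow> (\<forall>j\<in>J. f j \<in> A j)" for f
      by (auto simp: prod_emb_def PiE_iff)
    have "emeasure (distr M ?Pi (\<lambda>\<omega> t. X t \<omega>)) ?E = emeasure M {\<omega> \<in> space M. \<forall>j\<in>J. X j \<omega> \<in> A j}"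
      unfolding emeasure_distr[OF XPi E] by (rule arg_cong[of _ _ "emeasure M"]) (auto simp: E_iff)
    also have "\<dots> = emeasure P {\<omega> \<in> space P. \<forall>j\<in>J. \<omega> j \<in> A j}"
      by (rule two_sided_BM_finite_dimensional_unique[OF BM P' J A])
    also have "\<dots> = emeasure (distr P ?Pi (\<lambda>\<omega>. \<omega>)) ?E"
      unfolding emeasure_distr[OF idP E] by (rule arg_cong[of _ _ "emeasure P"]) (auto simp: E_iff)
    finally show "emeasure (distr M ?Pi (\<lambda>\<omega> t. X t \<omega>)) ?E = emeasure (distr P ?Pi (\<lambda>\<omega>. \<omega>)) ?E" .
  qed auto
  show ?thesis
  proof (rule measure_eqI)
    show "sets (distr M path_space (\<lambda>\<omega> t. X t \<omega>)) = sets P" by (simp add: sets_P)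
    fix A assume "A \<in> sets (distr M path_space (\<lambda>\<omega> t. X t \<omega>))"
    then have A: "A \<in> sets path_space" by simp
    \<comment> \<open>Every event of \<open>path_space\<close> is the trace of a product event
      \<open>B\<close>. As the paths of \<open>X\<close> are continuous, \<open>A\<close> and
      \<open>B\<close> have the same preimage.\<close>
    then obtain B where B: "B \<in> sets ?Pi" and AB: "A = space path_space \<inter> B"
      unfolding space_path_space by (auto simp: path_space_def sets_restrict_space)
    have "emeasure (distr M path_space (\<lambda>\<omega> t. X t \<omega>)) A = emeasure M ((\<lambda>\<omega> t. X t \<omega>) -` A \<inter> space M)"
      by (rule emeasure_distr[OF X A])
    also have "(\<lambda>\<omega> t. X t \<omega>) -` A \<inter> space M = (\<lambda>\<omega> t. X t \<omega>) -` B \<inter> space M"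
      using measurable_space[OF X] by (auto simp: AB)
    also have "emeasure M \<dots> = emeasure (distr M ?Pi (\<lambda>\<omega> t. X t \<omega>)) B"
      by (rule emeasure_distr[OF XPi B, symmetric])
    also have "\<dots> = emeasure P ((\<lambda>\<omega>. \<omega>) -` B \<inter> space P)"
      unfolding eq by (rule emeasure_distr[OF idP B])
    also have "(\<lambda>\<omega>. \<omega>) -` B \<inter> space P = A" by (auto simp: AB space_P)
    finally show "emeasure (distr M path_space (\<lambda>\<omega> t. X t \<omega>)) A = emeasure P A" .
  qed
qed

section \<open>Joint measurability of path evaluation\<close>

lemma measurable_path_space_eval:
  "(\<lambda>(t, \<omega>). \<omega> t) \<in> borel_measurable (borel \<Otimes>\<^sub>M path_space)"
proof (rule borel_measurable_LIMSEQ_metric)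
  fix i :: nat
  \<comment> \<open>Round the time down to a multiple of \<open>1 / Suc i\<close>. The rounded time
    takes countably many values, so measurability of single coordinates suffices; continuity of the
    path then gives the limit.\<close>
  have g: "(\<lambda>(t, \<omega>). \<lfloor>real (Suc i) * t\<rfloor>) \<in> measurable (borel \<Otimes>\<^sub>M path_space) (count_space UNIV)"
    by measurable
  have "(\<lambda>x. snd x (of_int (k::int) / real (Suc i))) \<in> borel_measurable (borel \<Otimes>\<^sub>M path_space)" for k
    by (rule measurable_compose[OF measurable_snd measurable_path_space_component])
  from measurable_compose_countable[OF this g]
  show "(\<lambda>(t, \<omega>). \<omega> (of_int \<lfloor>real (Suc i) * t\<rfloor> / real (Suc i))) \<in> borel_measurable (borel \<Otimes>\<^sub>M path_space)"
    by (simp add: case_prod_unfold)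
next
  fix x :: "real \<times> (real \<Rightarrow> real)" assume "x \<in> space (borel \<Otimes>\<^sub>M path_space)"
  then obtain t \<omega> where x: "x = (t, \<omega>)" and cont: "continuous_on UNIV \<omega>"
    by (auto simp: space_pair_measure space_path_space)
  have "(\<lambda>i. of_int \<lfloor>real (Suc i) * t\<rfloor> / real (Suc i)) \<longlonglongrightarrow> t"
  proof (rule tendsto_sandwich)
    show "\<forall>\<^sub>F i in sequentially. t - 1 / real (Suc i) \<le> of_int \<lfloor>real (Suc i) * t\<rfloor> / real (Suc i)"
    proof (intro always_eventually allI)
      fix i
      have "t - 1 / real (Suc i) = (real (Suc i) * t - 1) / real (Suc i)"
        by (simp add: diff_divide_distrib del: of_nat_Suc)
      also have "\<dots> \<le> of_int \<lfloor>real (Suc i) * t\<rfloor> / real (Suc i)"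
        by (intro divide_right_mono) linarith+
      finally show "t - 1 / real (Suc i) \<le> of_int \<lfloor>real (Suc i) * t\<rfloor> / real (Suc i)" .
    qed
    show "\<forall>\<^sub>F i in sequentially. of_int \<lfloor>real (Suc i) * t\<rfloor> / real (Suc i) \<le> t"
      by (intro always_eventually allI) (simp add: divide_le_eq mult.commute del: of_nat_Suc)
    show "(\<lambda>i. t - 1 / real (Suc i)) \<longlonglongrightarrow> t"
      using tendsto_diff[OF tendsto_const LIMSEQ_inverse_real_of_nat, of t] by (simp add: inverse_eq_divide)
  qed simp
  moreover have "isCont \<omega> t"
    using cont by (simp add: continuous_on_eq_continuous_at)
  ultimately show "(\<lambda>i. (case x of (t, \<omega>) \<Rightarrow> \<omega> (of_int \<lfloor>real (Suc i) * t\<rfloor> / real (Suc i))))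
      \<longlonglongrightarrow> (case x of (t, \<omega>) \<Rightarrow> \<omega> t)"
    unfolding x prod.case by (rule isCont_tendsto_compose[rotated])
qed

lemma borel_measurable_path_eval:
  assumes "F \<in> borel_measurable M" and "G \<in> measurable M path_space"
  shows "(\<lambda>x. G x (F x)) \<in> borel_measurable M"
  using measurable_compose[OF measurable_Pair[OF assms] measurable_path_space_eval] by simp

section \<open>The weighted occupation functional and its mean growth\<close>

lemma normal_density_le:
  assumes "\<sigma> > 0"
  shows "normal_density \<mu> \<sigma> x \<le> 1 / \<sigma>"
proof -
  \<comment> \<open>Only \<open>2 * pi >= 1\<close> is used, which keeps pi out of all later
    bounds.\<close>
  have "\<sigma> = sqrt (\<sigma>\<^sup>2)" using assms by simp
  also have "\<dots> \<le> sqrt (2 * pi * \<sigma>\<^sup>2)"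
    using pi_gt3 by (intro real_sqrt_le_mono) (auto simp: mult_le_cancel_right1)
  finally have "1 / sqrt (2 * pi * \<sigma>\<^sup>2) \<le> 1 / \<sigma>"
    using assms by (intro divide_left_mono mult_pos_pos) auto
  moreover have "exp (- (x - \<mu>)\<^sup>2 / (2 * \<sigma>\<^sup>2)) \<le> 1" by simp
  ultimately have "1 / sqrt (2 * pi * \<sigma>\<^sup>2) * exp (- (x - \<mu>)\<^sup>2 / (2 * \<sigma>\<^sup>2)) \<le> 1 / \<sigma> * 1"
    using assms by (intro mult_mono) auto
  then show ?thesis by (simp add: normal_density_def)
qed

lemma std_normal_density_le_1: "ennreal (std_normal_density x) \<le> 1"
  using normal_density_le[of 1 0 x] by (simp add: ennreal_le_1)

text \<open>The Gaussian weight serves three ends: it is at most 1, so time increments bound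
  occupation; it is integrable, so mean occupation grows sublinearly; it is positive, so occupation
  detects positive times. The half-open interval is empty for \<open>u <= 0\<close>.\<close>

definition occupation :: "(real \<Rightarrow> real) \<Rightarrow> real \<Rightarrow> ennreal" where
  "occupation \<omega> u = (\<integral>\<^sup>+ s. ennreal (std_normal_density (\<omega> s)) * indicator {0<..u} s \<partial>lborel)"

lemma measurable_occupation[measurable (raw)]:
  assumes [measurable]: "F \<in> measurable M path_space" "S \<in> borel_measurable M"
  shows "(\<lambda>x. occupation (F x) (S x)) \<in> borel_measurable M"
proof -
  \<comment> \<open>The inner integral needs the integrand to be jointly measurable in
    \<open>x\<close> and the time; the indicator is then unfolded because its endpoint
    \<open>S x\<close> varies with \<open>x\<close>.\<close>
  have [measurable]: "(\<lambda>z. F (fst z) (snd z)) \<in> borel_measurable (M \<Otimes>\<^sub>M lborel)"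
    by (rule borel_measurable_path_eval[where F=snd and G="\<lambda>z. F (fst z)"]) measurable
  show ?thesis
    unfolding occupation_def indicator_def greaterThanAtMost_iff by measurable
qed

lemma occupation_add:
  assumes "continuous_on UNIV \<omega>" and "a \<ge> 0" and "b \<ge> 0"
  shows "occupation \<omega> (a + b) = occupation \<omega> a + occupation (\<lambda>s. \<omega> (a + s)) b"
proof -
  let ?f = "\<lambda>s. ennreal (std_normal_density (\<omega> s))"
  note [measurable] = borel_measurable_continuous_onI[OF assms(1)]
  have "occupation \<omega> (a + b) = (\<integral>\<^sup>+ s. ?f s * indicator {0<..a} s + ?f s * indicator {a<..a+b} s \<partial>lborel)"
    unfolding occupation_def using assms(2,3)
    by (intro nn_integral_cong) (auto simp: indicator_def)
  also have "\<dots> = occupation \<omega> a + (\<integral>\<^sup>+ s. ?f s * indicator {a<..a+b} s \<partial>lborel)"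
    unfolding occupation_def by (rule nn_integral_add) measurable
  also have "(\<integral>\<^sup>+ s. ?f s * indicator {a<..a+b} s \<partial>lborel) =
      (\<integral>\<^sup>+ s. ?f (a + 1 * s) * indicator {a<..a+b} (a + 1 * s) \<partial>lborel)"
    by (subst nn_integral_real_affine[where c=1 and t=a]) auto
  also have "\<dots> = occupation (\<lambda>s. \<omega> (a + s)) b"
    unfolding occupation_def by (intro nn_integral_cong) (auto simp: indicator_def)
  finally show ?thesis .
qed

text \<open>Times beyond \<open>v\<close> have weight at most 1. Since \<open>ennreal\<close> sends
  negative reals to 0, the last term is the positive part of \<open>u - v\<close>, and no order
  between \<open>u\<close> and \<open>v\<close> has to be assumed.\<close>

lemma occupation_le:
  assumes "continuous_on UNIV \<omega>"
  shows "occupation \<omega> u \<le> occupation \<omega> v + ennreal (u - v)"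
proof -
  note [measurable] = borel_measurable_continuous_onI[OF assms]
  have "occupation \<omega> u \<le> (\<integral>\<^sup>+ s. ennreal (std_normal_density (\<omega> s)) * indicator {0<..v} s
      + indicator {v<..u} s \<partial>lborel)"
    unfolding occupation_def
  proof (intro nn_integral_mono)
    fix s
    show "ennreal (std_normal_density (\<omega> s)) * indicator {0<..u} s \<le>
        ennreal (std_normal_density (\<omega> s)) * indicator {0<..v} s + indicator {v<..u} s"
      using std_normal_density_le_1[of "\<omega> s"] by (auto simp: indicator_def)
  qed
  also have "\<dots> = occupation \<omega> v + emeasure lborel {v<..u}"
    unfolding occupation_def by (subst nn_integral_add) auto
  also have "emeasure lborel {v<..u} = ennreal (u - v)"
    by (cases "v \<le> u") (auto simp: ennreal_neg)
  finally show ?thesis .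
qed

lemma occupation_pos:
  assumes "continuous_on UNIV \<omega>" and "u > 0"
  shows "occupation \<omega> u \<noteq> 0"
proof
  note [measurable] = borel_measurable_continuous_onI[OF assms(1)]
  assume "occupation \<omega> u = 0"
  then have "AE s in lborel. ennreal (std_normal_density (\<omega> s)) * indicator {0<..u} s = 0"
    unfolding occupation_def by (subst (asm) nn_integral_0_iff_AE) auto
  \<comment> \<open>The weight never vanishes, so the integrand can be zero only off the interval;
    the interval would then be null despite its length \<open>u > 0\<close>.\<close>
  then have "AE s in lborel. s \<notin> {0<..u}"
  proof eventually_elim
    case (elim s)
    moreover have "std_normal_density (\<omega> s) > 0" by (rule normal_density_pos) simp
    ultimately show ?case by (auto simp: indicator_def ennreal_eq_0_iff split: if_splits)
  qed
  then have "emeasure lborel {0<..u} = 0"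
    by (subst (asm) AE_iff_measurable[where N="{0<..u}"]) auto
  with \<open>u > 0\<close> show False by simp
qed

text \<open>The law of \<open>X s\<close> has a density bounded by \<open>1 / sqrt s\<close>, and
  the weight integrates to 1.\<close>

lemma two_sided_BM_expectation_density_le:
  assumes BM: "two_sided_BM M X" and "s > 0"
  shows "(\<integral>\<^sup>+ \<omega>. ennreal (std_normal_density (X s \<omega>)) \<partial>M) \<le> ennreal (1 / sqrt s)"
proof -
  have X0: "AE \<omega> in M. X 0 \<omega> = 0"
    and D: "distributed M lborel (\<lambda>\<omega>. X s \<omega> - X 0 \<omega>) (normal_density 0 (sqrt s))"
    using assms by (auto simp: two_sided_BM_def dest: spec[of _ 0])
  have "(\<integral>\<^sup>+ \<omega>. ennreal (std_normal_density (X s \<omega>)) \<partial>M) =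
      (\<integral>\<^sup>+ \<omega>. ennreal (std_normal_density (X s \<omega> - X 0 \<omega>)) \<partial>M)"
    using X0 by (intro nn_integral_cong_AE) auto
  also have "\<dots> = (\<integral>\<^sup>+ x. ennreal (normal_density 0 (sqrt s) x) * ennreal (std_normal_density x) \<partial>lborel)"
    by (rule distributed_nn_integral[OF D, symmetric]) simp
  also have "\<dots> \<le> (\<integral>\<^sup>+ x. ennreal (1 / sqrt s) * ennreal (std_normal_density x) \<partial>lborel)"
    using \<open>s > 0\<close> by (intro nn_integral_mono mult_right_mono ennreal_leI normal_density_le) auto
  also have "\<dots> = ennreal (1 / sqrt s) * (\<integral>\<^sup>+ x. ennreal (std_normal_density x) \<partial>lborel)"
    by (rule nn_integral_cmult) simp
  also have "(\<integral>\<^sup>+ x. ennreal (std_normal_density x) \<partial>lborel) = 1"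
    using prob_space.emeasure_space_1[OF prob_space_normal_density[of 1 0]] by (simp add: emeasure_density)
  finally show ?thesis by simp
qed

text \<open>Splitting at time \<open>m^2\<close>, the mean weight is at most 1 before and at most
  \<open>1 / m\<close> after. The free parameter replaces the integration of
  \<open>1 / sqrt s\<close>: for \<open>u\<close> of order \<open>m^3\<close> both terms have order
  \<open>m^2\<close>.\<close>

lemma BM_law_expected_occupation_le:
  assumes P: "BM_law P" and "m > 0" and "u \<ge> 0"
  shows "(\<integral>\<^sup>+ \<omega>. occupation \<omega> u \<partial>P) \<le> ennreal (m\<^sup>2 + u / m)"
proof -
  have sets_P[measurable_cong]: "sets P = sets path_space" and BM: "two_sided_BM P (\<lambda>t \<omega>. \<omega> t)"
    using P by (auto simp: BM_law_def)
  interpret prob_space P using BM by (rule two_sided_BM_prob_space)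
  interpret pair_sigma_finite lborel P ..
  have [measurable]: "(\<lambda>z. snd z (fst z)) \<in> borel_measurable (lborel \<Otimes>\<^sub>M P)"
    by (rule borel_measurable_path_eval[where F=fst and G=snd]) measurable
  have dens: "(\<integral>\<^sup>+ \<omega>. ennreal (std_normal_density (\<omega> s)) \<partial>P) \<le> indicator {0<..m\<^sup>2} s + ennreal (1 / m)" if "s > 0" for s
  proof (cases "s \<le> m\<^sup>2")
    case True
    have "(\<integral>\<^sup>+ \<omega>. ennreal (std_normal_density (\<omega> s)) \<partial>P) \<le> (\<integral>\<^sup>+ \<omega>. 1 \<partial>P)"
      by (intro nn_integral_mono std_normal_density_le_1)
    also have "\<dots> = 1" by (simp add: emeasure_space_1)
    finally show ?thesis using True that by (simp add: add_increasing2)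
  next
    case False
    then have "m \<le> sqrt s" using \<open>m > 0\<close> by (intro real_le_rsqrt) auto
    then have "ennreal (1 / sqrt s) \<le> ennreal (1 / m)"
      using \<open>m > 0\<close> that by (intro ennreal_leI divide_left_mono mult_pos_pos) auto
    with two_sided_BM_expectation_density_le[OF BM that] show ?thesis
      by (simp add: add_increasing order_trans)
  qed
  have "(\<integral>\<^sup>+ \<omega>. occupation \<omega> u \<partial>P) =
      (\<integral>\<^sup>+ s. \<integral>\<^sup>+ \<omega>. ennreal (std_normal_density (\<omega> s)) * indicator {0<..u} s \<partial>P \<partial>lborel)"
    unfolding occupation_def by (rule Fubini') measurable
  also have "\<dots> \<le> (\<integral>\<^sup>+ s. indicator {0<..m\<^sup>2} s + ennreal (1 / m) * indicator {0<..u} s \<partial>lborel)"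
  proof (intro nn_integral_mono)
    fix s
    show "(\<integral>\<^sup>+ \<omega>. ennreal (std_normal_density (\<omega> s)) * indicator {0<..u} s \<partial>P) \<le>
        indicator {0<..m\<^sup>2} s + ennreal (1 / m) * indicator {0<..u} s"
      using dens[of s] by (cases "s \<in> {0<..u}") auto
  qed
  also have "\<dots> = ennreal (m\<^sup>2) + ennreal (1 / m) * ennreal u"
    using \<open>u \<ge> 0\<close> by (subst nn_integral_add) (auto simp: nn_integral_cmult)
  also have "\<dots> = ennreal (m\<^sup>2 + u / m)"
    using \<open>u \<ge> 0\<close> \<open>m > 0\<close> by (simp add: ennreal_mult[symmetric] ennreal_plus[symmetric] del: ennreal_plus)
  finally show ?thesis .
qed

section \<open>Iterating the shift and comparing with deterministic times\<close>

primrec iterated_shift :: "((real \<Rightarrow> real) \<Rightarrow> real) \<Rightarrow> nat \<Rightarrow> (real \<Rightarrow> real) \<Rightarrow> real" where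
  "iterated_shift T 0 \<omega> = 0"
| "iterated_shift T (Suc n) \<omega> = T \<omega> + iterated_shift T n (shifted_path T \<omega>)"

locale zero_shift =
  fixes P :: "(real \<Rightarrow> real) measure" and T :: "(real \<Rightarrow> real) \<Rightarrow> real"
  assumes law: "BM_law P"
    and shift: "unbiased_shift P T"
    and T_nonneg: "AE \<omega> in P. T \<omega> \<ge> 0"
    and T_zero: "AE \<omega> in P. \<omega> (T \<omega>) = 0"
begin

lemma sets_P[measurable_cong]: "sets P = sets path_space"
  using law by (simp add: BM_law_def)

lemma continuous_path: "\<omega> \<in> space P \<Longrightarrow> continuous_on UNIV \<omega>"
  using sets_eq_imp_space_eq[OF sets_P] by (simp add: space_path_space)

lemma T_measurable[measurable]: "T \<in> borel_measurable path_space"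
  using shift by (simp add: unbiased_shift_def random_time_def)

lemma shifted_path_BM: "two_sided_BM P (\<lambda>t \<omega>. shifted_path T \<omega> t)"
  using shift by (simp add: unbiased_shift_def)

lemma shifted_path_measurable: "shifted_path T \<in> measurable P path_space"
  using two_sided_BM_measurable_path[OF shifted_path_BM] by simp

lemma shifted_path_measurable'[measurable]: "shifted_path T \<in> measurable path_space path_space"
  using shifted_path_measurable sets_P by (simp cong: measurable_cong_sets)

text \<open>This is how unbiasedness enters: the shifted path is again a two-sided Brownian motion,
  whose law is unique, so the shift preserves \<open>P\<close> and can be iterated.\<close>

lemma distr_shifted_path: "distr P path_space (shifted_path T) = P"
  using two_sided_BM_distr[OF shifted_path_BM law] by simp

lemma nn_integral_shifted_path:
  assumes "h \<in> borel_measurable path_space"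
  shows "(\<integral>\<^sup>+ \<omega>. h (shifted_path T \<omega>) \<partial>P) = (\<integral>\<^sup>+ \<omega>. h \<omega> \<partial>P)"
  using nn_integral_distr[OF shifted_path_measurable, of h] assms by (simp add: distr_shifted_path)

lemma AE_shifted_path:
  assumes "AE \<omega> in P. Q \<omega>"
  shows "AE \<omega> in P. Q (shifted_path T \<omega>)"
  by (rule AE_distrD[OF shifted_path_measurable]) (subst distr_shifted_path, rule assms)

lemma iterated_shift_measurable[measurable]: "iterated_shift T n \<in> borel_measurable path_space"
  by (induction n) simp_all

lemma iterated_shift_nonneg: "AE \<omega> in P. iterated_shift T n \<omega> \<ge> 0"
proof (induction n)
  case (Suc n)
  from T_nonneg AE_shifted_path[OF this] show ?case
    by eventually_elim simp
qed simp

text \<open>Split the occupation at time \<open>T\<close>. The recursion shifts the path before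
  iterating, so the part after \<open>T\<close> is the occupation of the shifted path up to its own
  \<open>n\<close>-th iterate, and invariance of \<open>P\<close> reduces it to the induction
  hypothesis.\<close>

lemma expected_occupation_iterated_shift:
  "(\<integral>\<^sup>+ \<omega>. occupation \<omega> (iterated_shift T n \<omega>) \<partial>P) = of_nat n * (\<integral>\<^sup>+ \<omega>. occupation \<omega> (T \<omega>) \<partial>P)"
proof (induction n)
  case 0
  then show ?case by (simp add: occupation_def)
next
  case (Suc n)
  have "(\<integral>\<^sup>+ \<omega>. occupation \<omega> (iterated_shift T (Suc n) \<omega>) \<partial>P) =
    (\<integral>\<^sup>+ \<omega>. occupation \<omega> (T \<omega>) + occupation (shifted_path T \<omega>) (iterated_shift T n (shifted_path T \<omega>)) \<partial>P)"
  proof (rule nn_integral_cong_AE)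
    \<comment> \<open>Because the path vanishes at time \<open>T\<close>, subtracting its value
      there changes nothing: the translated path in \<open>occupation_add\<close> is exactly the
      shifted path.\<close>
    show "AE \<omega> in P. occupation \<omega> (iterated_shift T (Suc n) \<omega>) =
        occupation \<omega> (T \<omega>) + occupation (shifted_path T \<omega>) (iterated_shift T n (shifted_path T \<omega>))"
      using T_nonneg T_zero AE_shifted_path[OF iterated_shift_nonneg[of n]] AE_space
      by eventually_elim (simp add: occupation_add continuous_path shifted_path_def)
  qed
  also have "\<dots> = (\<integral>\<^sup>+ \<omega>. occupation \<omega> (T \<omega>) \<partial>P) +
      (\<integral>\<^sup>+ \<omega>. occupation (shifted_path T \<omega>) (iterated_shift T n (shifted_path T \<omega>)) \<partial>P)"
    by (rule nn_integral_add) measurable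
  also have "(\<integral>\<^sup>+ \<omega>. occupation (shifted_path T \<omega>) (iterated_shift T n (shifted_path T \<omega>)) \<partial>P) =
      (\<integral>\<^sup>+ \<omega>. occupation \<omega> (iterated_shift T n \<omega>) \<partial>P)"
    by (rule nn_integral_shifted_path) measurable
  finally show ?case
    by (simp add: Suc.IH distrib_right)
qed

text \<open>The integrands are positive parts. Charging \<open>K\<close> to each summand of the
  iterate, subadditivity and invariance of \<open>P\<close> give one copy of the mean excess of
  \<open>T\<close> per step.\<close>

lemma iterated_shift_excess_le:
  "(\<integral>\<^sup>+ \<omega>. ennreal (iterated_shift T n \<omega> - K * real n) \<partial>P) \<le> of_nat n * (\<integral>\<^sup>+ \<omega>. ennreal (T \<omega> - K) \<partial>P)"
proof (induction n)
  case (Suc n)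
  have "(\<integral>\<^sup>+ \<omega>. ennreal (iterated_shift T (Suc n) \<omega> - K * real (Suc n)) \<partial>P) \<le>
      (\<integral>\<^sup>+ \<omega>. ennreal (T \<omega> - K) + ennreal (iterated_shift T n (shifted_path T \<omega>) - K * real n) \<partial>P)"
  proof (intro nn_integral_mono)
    fix \<omega>
    have "ennreal (a + b) \<le> ennreal a + ennreal b" for a b :: real
      by (cases "a \<ge> 0"; cases "b \<ge> 0") (auto simp: ennreal_neg intro!: ennreal_leI)
    from this[of "T \<omega> - K" "iterated_shift T n (shifted_path T \<omega>) - K * real n"]
    show "ennreal (iterated_shift T (Suc n) \<omega> - K * real (Suc n)) \<le>
        ennreal (T \<omega> - K) + ennreal (iterated_shift T n (shifted_path T \<omega>) - K * real n)"
      by (simp add: algebra_simps)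
  qed
  also have "\<dots> = (\<integral>\<^sup>+ \<omega>. ennreal (T \<omega> - K) \<partial>P) +
      (\<integral>\<^sup>+ \<omega>. ennreal (iterated_shift T n (shifted_path T \<omega>) - K * real n) \<partial>P)"
    by (rule nn_integral_add) measurable
  also have "(\<integral>\<^sup>+ \<omega>. ennreal (iterated_shift T n (shifted_path T \<omega>) - K * real n) \<partial>P) =
      (\<integral>\<^sup>+ \<omega>. ennreal (iterated_shift T n \<omega> - K * real n) \<partial>P)"
    by (rule nn_integral_shifted_path[where h="\<lambda>\<omega>. ennreal (iterated_shift T n \<omega> - K * real n)"]) measurable
  finally show ?case
    using Suc.IH by (simp add: distrib_right add_left_mono order_trans)
qed simp

text \<open>Over \<open>n\<close> iterations, mean occupation is linear in \<open>n\<close>. It is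
  bounded by the occupation up to time \<open>K n\<close>, which is sublinear in mean, plus an
  excess of at most \<open>n\<close> times the right-hand side; division by \<open>n\<close> removes
  the sublinear term.\<close>

lemma expected_occupation_le_excess:
  assumes "K \<ge> 0"
  shows "(\<integral>\<^sup>+ \<omega>. occupation \<omega> (T \<omega>) \<partial>P) \<le> (\<integral>\<^sup>+ \<omega>. ennreal (T \<omega> - K) \<partial>P)"
    (is "?g \<le> ?c")
proof (rule ennreal_le_epsilon)
  fix e :: real assume "e > 0"
  \<comment> \<open>Run \<open>m\<^sup>3\<close> iterations: the occupation up to time \<open>K m\<^sup>3\<close> then has mean at most
    \<open>m\<^sup>2 + K m\<^sup>2\<close>, which vanishes after division by \<open>m\<^sup>3\<close>.\<close>
  obtain m :: nat where m: "real m > (1 + K) / e" using reals_Archimedean2 by blast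
  have "(1 + K) / e > 0" using \<open>e > 0\<close> assms by simp
  with m have m0: "real m > 0" by linarith
  let ?n = "m ^ 3"
  have "of_nat ?n * ?g = (\<integral>\<^sup>+ \<omega>. occupation \<omega> (iterated_shift T ?n \<omega>) \<partial>P)"
    by (simp only: expected_occupation_iterated_shift)
  also have "\<dots> \<le> (\<integral>\<^sup>+ \<omega>. occupation \<omega> (K * real ?n) + ennreal (iterated_shift T ?n \<omega> - K * real ?n) \<partial>P)"
    by (intro nn_integral_mono occupation_le continuous_path)
  also have "\<dots> = (\<integral>\<^sup>+ \<omega>. occupation \<omega> (K * real ?n) \<partial>P) + (\<integral>\<^sup>+ \<omega>. ennreal (iterated_shift T ?n \<omega> - K * real ?n) \<partial>P)"
    by (rule nn_integral_add) measurable
  also have "\<dots> \<le> ennreal ((real m)\<^sup>2 + K * real ?n / real m) + of_nat ?n * ?c"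
    using assms m0 by (intro add_mono BM_law_expected_occupation_le law iterated_shift_excess_le) auto
  also have "(real m)\<^sup>2 + K * real ?n / real m = real ?n * ((1 + K) / real m)"
    using m0 by (simp add: field_simps power2_eq_square power3_eq_cube)
  also have "ennreal \<dots> = of_nat ?n * ennreal ((1 + K) / real m)"
    using assms by (subst ennreal_mult) (auto simp: ennreal_of_nat_eq_real_of_nat)
  also have "of_nat ?n * ennreal ((1 + K) / real m) + of_nat ?n * ?c = of_nat ?n * (?c + ennreal ((1 + K) / real m))"
    by (simp add: distrib_left add.commute)
  \<comment> \<open>The common factor \<open>m^3\<close> may be cancelled in \<open>ennreal\<close>
    because it is positive and finite.\<close>
  finally have "?g \<le> ?c + ennreal ((1 + K) / real m)"
    using m0 by (subst (asm) ennreal_mult_le_mult_iff) (auto simp: ennreal_of_nat_eq_real_of_nat)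
  also have "\<dots> \<le> ?c + ennreal e"
    using m m0 \<open>e > 0\<close> by (intro add_left_mono ennreal_leI) (simp add: field_simps)
  finally show "?g \<le> ?c + ennreal e" .
qed

text \<open>The mean excess over level \<open>k\<close> bounds the mean occupation for every
  \<open>k\<close> and tends to 0 by dominated convergence with the integrable majorant
  \<open>T\<close>.\<close>

lemma shift_eq_0_if_finite_expectation:
  assumes "(\<integral>\<^sup>+ \<omega>. ennreal (T \<omega>) \<partial>P) \<noteq> \<infinity>"
  shows "AE \<omega> in P. T \<omega> = 0"
proof -
  have "(\<lambda>k. \<integral>\<^sup>+ \<omega>. ennreal (T \<omega> - real k) \<partial>P) \<longlonglongrightarrow> (\<integral>\<^sup>+ \<omega>. 0 \<partial>P)"
  proof (rule nn_integral_dominated_convergence[where w="\<lambda>\<omega>. ennreal (T \<omega>)"])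
    show "(\<integral>\<^sup>+ \<omega>. ennreal (T \<omega>) \<partial>P) < \<infinity>"
      using assms by (simp add: less_top)
    show "AE \<omega> in P. (\<lambda>k. ennreal (T \<omega> - real k)) \<longlonglongrightarrow> 0"
    proof (intro AE_I2 tendsto_eventually)
      fix \<omega>
      \<comment> \<open>Once \<open>k\<close> exceeds \<open>T\<close>, the difference is negative
        and \<open>ennreal\<close> truncates it to 0.\<close>
      show "\<forall>\<^sub>F k in sequentially. ennreal (T \<omega> - real k) = 0"
        using eventually_ge_at_top[of "nat \<lceil>T \<omega>\<rceil>"]
        by eventually_elim (auto simp: ennreal_neg nat_ceiling_le_eq)
    qed
  qed (auto intro!: ennreal_leI)
  then have "(\<integral>\<^sup>+ \<omega>. occupation \<omega> (T \<omega>) \<partial>P) \<le> (\<integral>\<^sup>+ \<omega>. 0 \<partial>P)"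
    by (rule LIMSEQ_le_const) (auto intro!: exI[of _ 0] expected_occupation_le_excess)
  then have "(\<integral>\<^sup>+ \<omega>. occupation \<omega> (T \<omega>) \<partial>P) = 0"
    by simp
  then have "AE \<omega> in P. occupation \<omega> (T \<omega>) = 0"
    by (subst (asm) nn_integral_0_iff_AE) auto
  with T_nonneg AE_space show ?thesis
  proof eventually_elim
    case (elim \<omega>)
    then have "\<not> T \<omega> > 0" using occupation_pos[OF continuous_path] by blast
    with elim show ?case by simp
  qed
qed

end

theorem theorem8p5:
  fixes P0 :: "(real \<Rightarrow> real) measure" and T :: "(real \<Rightarrow> real) \<Rightarrow> real"
  assumes "BM_law P0"
    and "unbiased_shift P0 T"
    and "AE \<omega> in P0. T \<omega> \<ge> 0"
    and "measure P0 {\<omega> \<in> space P0. \<omega> (T \<omega>) = 0} = 1"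
    and "measure P0 {\<omega> \<in> space P0. T \<omega> > 0} > 0"
  shows "(\<integral>\<^sup>+ \<omega>. ennreal (T \<omega>) \<partial>P0) = \<infinity>"
proof (rule ccontr)
  assume fin: "(\<integral>\<^sup>+ \<omega>. ennreal (T \<omega>) \<partial>P0) \<noteq> \<infinity>"
  interpret prob_space P0
    using assms(1) by (auto simp: BM_law_def dest: two_sided_BM_prob_space)
  interpret zero_shift P0 T
    using assms AE_prob_1[OF assms(4)] by unfold_locales auto
  \<comment> \<open>A finite mean would make the event of a positive shift null, against its assumed
    positive probability.\<close>
  from shift_eq_0_if_finite_expectation[OF fin]
  have "AE \<omega> in P0. \<omega> \<notin> {\<omega> \<in> space P0. T \<omega> > 0}"
    by eventually_elim simp
  then have "measure P0 {\<omega> \<in> space P0. T \<omega> > 0} = 0"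
    by (subst prob_eq_0) measurable
  with assms(5) show False by simp
qed

end
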